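(* Let $d\ge 2$ be an integer, let $j=(d-1)/2$, and let $V_j$ be the irreducible spin-$j$ representation of $SU(2)$, of dimension $d=2j+1$. There is no $4$-valent invariant perfect tensor of local dimension $d$; that is, there is no unit vector $|\psi_4\rangle\in V_j^{\otimes 4}$ that is both invariant and perfect.
   Context: For $n\ge 2$, an $n$-qudit state ($n$-valent tensor of local dimension $d=2j+1$) is a unit vector $|\psi_n\rangle\in V_j^{\otimes n}$, where $V_j$ carries its standard $SU(2)$-invariant Hermitian inner product and angular momentum operators $J^1,J^2,J^3$ with $[J^a,J^b]=i\epsilon^{abc}J^c$. Invariant: $\big(\sum_{i=1}^n J^{a}_i\big)|\psi_n\rangle=0$ for $a=1,2,3$, where $J^a_i$ is $J^a$ acting on the $i$-th tensor factor (equivalently, $|\psi_n\rangle$ is fixed by the diagonal action of $SU(2)$). Perfect: for every subset $A\subseteq\{1,\dots,n\}$ of tensor factors with $1\le |A|\le\lfloor n/2\rfloor$, the reduced density matrix $\rho_A=\mathrm{Tr}_{\overline{A}}|\psi_n\rangle\langle\psi_n|$ (partial trace over the factors not in $A$) has maximal von Neumann entropy, i.e. $\rho_A=d^{-|A|}\,\mathbb{I}_{d^{|A|}}$. An invariant perfect tensor (IPT) is an $n$-qudit state that is both invariant and perfect. *)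

theory Defs
  imports
    Complex_Main
    "HOL-Library.FuncSet"
    "Jordan_Normal_Form.Matrix"
    "Jordan_Normal_Form.Schur_Decomposition"
begin

section \<open>The spin-j representation in its standard weight basis\<close>

text \<open>
  The space V_j of dimension d = 2j + 1 is identified with complex d-space through the
  orthonormal weight basis: the k-th basis vector (k = 0, ..., d - 1) is the eigenvector of
  J^3 of weight m = j - k.  The ladder operators are given by
  J^+ |m> = sqrt (j (j + 1) - m (m + 1)) |m + 1> and
  J^- |m> = sqrt (j (j + 1) - m (m - 1)) |m - 1>.
\<close>

definition spin :: "nat \<Rightarrow> real" where
  "spin d = (real d - 1) / 2"

definition weight :: "nat \<Rightarrow> nat \<Rightarrow> real" where
  "weight d k = spin d - real k"

definition J_plus :: "nat \<Rightarrow> complex mat" where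
  "J_plus d = mat d d (\<lambda>(k, l). if l = Suc k
     then complex_of_real (sqrt (spin d * (spin d + 1) - weight d l * (weight d l + 1))) else 0)"

definition J_minus :: "nat \<Rightarrow> complex mat" where
  "J_minus d = mat d d (\<lambda>(k, l). if k = Suc l
     then complex_of_real (sqrt (spin d * (spin d + 1) - weight d l * (weight d l - 1))) else 0)"

definition J1 :: "nat \<Rightarrow> complex mat" where
  "J1 d = (1 / 2) \<cdot>\<^sub>m (J_plus d + J_minus d)"

definition J2 :: "nat \<Rightarrow> complex mat" where
  "J2 d = (1 / (2 * \<i>)) \<cdot>\<^sub>m (J_plus d - J_minus d)"

definition J3 :: "nat \<Rightarrow> complex mat" where
  "J3 d = mat d d (\<lambda>(k, l). if k = l then complex_of_real (weight d k) else 0)"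

text \<open>
  These are self-adjoint, satisfy the angular momentum commutation relations, and have Casimir
  operator j (j + 1), which in dimension 2j + 1 characterises the irreducible spin-j
  representation.
\<close>

definition ladder :: "nat \<Rightarrow> nat \<Rightarrow> complex" where
  "ladder d k = complex_of_real (sqrt (real (Suc k) * real (d - Suc k)))"

lemma J_plus_ladder: "J_plus d = mat d d (\<lambda>(k, l). if l = Suc k then ladder d k else 0)"
proof -
  have "spin d * (spin d + 1) - weight d (Suc k) * (weight d (Suc k) + 1)
      = real (Suc k) * real (d - Suc k)" if "Suc k < d" for k
    using that by (simp add: spin_def weight_def of_nat_diff field_simps)
  then show ?thesis
    unfolding J_plus_def ladder_def by (intro eq_matI) auto
qed

lemma J_minus_ladder: "J_minus d = mat d d (\<lambda>(k, l). if k = Suc l then ladder d l else 0)"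
proof -
  have "spin d * (spin d + 1) - weight d k * (weight d k - 1)
      = real (Suc k) * real (d - Suc k)" if "Suc k < d" for k
    using that by (simp add: spin_def weight_def of_nat_diff field_simps)
  then show ?thesis
    unfolding J_minus_def ladder_def by (intro eq_matI) auto
qed

lemma J_carrier [simp]:
  "J_plus d \<in> carrier_mat d d" "J_minus d \<in> carrier_mat d d"
  "J1 d \<in> carrier_mat d d" "J2 d \<in> carrier_mat d d" "J3 d \<in> carrier_mat d d"
  by (auto simp: J_plus_def J_minus_def J1_def J2_def J3_def intro!: minus_carrier_mat)

lemma J_dims [simp]:
  "dim_row (J1 d) = d" "dim_col (J1 d) = d" "dim_row (J2 d) = d" "dim_col (J2 d) = d"
  "dim_row (J3 d) = d" "dim_col (J3 d) = d"
  by (simp_all add: J_plus_def J_minus_def J1_def J2_def J3_def)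

lemma mult_entry:
  fixes A B :: "complex mat"
  assumes "A \<in> carrier_mat d d" "B \<in> carrier_mat d d" "k < d" "l < d"
  shows "(A * B) $$ (k, l) = (\<Sum>i = 0..<d. A $$ (k, i) * B $$ (i, l))"
  using assms by (simp add: scalar_prod_def)

lemma J_selfadjoint:
  "mat_adjoint (J1 d) = J1 d" "mat_adjoint (J2 d) = J2 d" "mat_adjoint (J3 d) = J3 d"
  unfolding J1_def J2_def J3_def J_plus_ladder J_minus_ladder
  by (intro eq_matI; auto simp: mat_adjoint_def mat_of_rows_def ladder_def)+

lemma ladder_sq: "k < d \<Longrightarrow> ladder d k * ladder d k = of_nat (Suc k) * (of_nat d - of_nat (Suc k))"
proof -
  assume "k < d"
  have "ladder d k * ladder d k
      = complex_of_real (sqrt (real (Suc k) * real (d - Suc k)) * sqrt (real (Suc k) * real (d - Suc k)))"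
    unfolding ladder_def by (simp only: of_real_mult)
  also have "\<dots> = complex_of_real (real (Suc k) * real (d - Suc k))"
    by (subst real_sqrt_mult_self) simp
  finally show ?thesis using \<open>k < d\<close> by (simp add: of_nat_diff)
qed

lemma J_plus_minus:
  assumes "k < d" "l < d"
  shows "(J_plus d * J_minus d) $$ (k, l)
      = (if k = l then of_nat (Suc k) * (of_nat d - of_nat (Suc k)) else 0)"
proof -
  have "(J_plus d * J_minus d) $$ (k, l)
      = (\<Sum>i = 0..<d. if i = Suc k then (if k = l then ladder d k * ladder d k else 0) else 0)"
    unfolding mult_entry[OF J_carrier(1) J_carrier(2) assms]
    using assms by (intro sum.cong) (auto simp: J_plus_ladder J_minus_ladder)
  also have "\<dots> = (if k = l then ladder d k * ladder d k else 0)"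
  proof (cases "Suc k < d")
    case False
    then have "ladder d k = 0" by (simp add: ladder_def)
    with False show ?thesis by auto
  qed simp
  finally show ?thesis using assms by (simp add: ladder_sq)
qed

lemma J_minus_plus:
  assumes "k < d" "l < d"
  shows "(J_minus d * J_plus d) $$ (k, l) = (if k = l then of_nat k * (of_nat d - of_nat k) else 0)"
proof -
  have "(J_minus d * J_plus d) $$ (k, l)
      = (\<Sum>i = 0..<d. if k = Suc i then (if k = l then ladder d i * ladder d i else 0) else 0)"
    unfolding mult_entry[OF J_carrier(2) J_carrier(1) assms]
    using assms by (intro sum.cong) (auto simp: J_plus_ladder J_minus_ladder)
  also have "\<dots> = (if k = l then of_nat k * (of_nat d - of_nat k) else 0)"
  proof (cases k)
    case 0
    then show ?thesis by simp
  next
    case (Suc m)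
    have "(\<Sum>i = 0..<d. if k = Suc i then (if k = l then ladder d i * ladder d i else 0) else 0)
        = (\<Sum>i = 0..<d. if i = m then (if k = l then ladder d m * ladder d m else 0) else 0)"
      using Suc by (intro sum.cong) auto
    also have "\<dots> = (if k = l then ladder d m * ladder d m else 0)"
      using Suc assms by simp
    finally show ?thesis using Suc assms by (simp add: ladder_sq)
  qed
  finally show ?thesis .
qed

lemma J3_mult_left:
  assumes "A \<in> carrier_mat d d" "k < d" "l < d"
  shows "(J3 d * A) $$ (k, l) = complex_of_real (weight d k) * A $$ (k, l)"
proof -
  have "(J3 d * A) $$ (k, l)
      = (\<Sum>i = 0..<d. if i = k then complex_of_real (weight d k) * A $$ (k, l) else 0)"
    unfolding mult_entry[OF J_carrier(5) assms(1) assms(2,3)]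
    using assms by (intro sum.cong) (auto simp: J3_def)
  with assms show ?thesis by simp
qed

lemma J3_mult_right:
  assumes "A \<in> carrier_mat d d" "k < d" "l < d"
  shows "(A * J3 d) $$ (k, l) = A $$ (k, l) * complex_of_real (weight d l)"
proof -
  have "(A * J3 d) $$ (k, l)
      = (\<Sum>i = 0..<d. if i = l then A $$ (k, l) * complex_of_real (weight d l) else 0)"
    unfolding mult_entry[OF assms(1) J_carrier(5) assms(2,3)]
    using assms by (intro sum.cong) (auto simp: J3_def)
  with assms show ?thesis by simp
qed

lemma smult_add_mult_entry:
  fixes A B C D :: "complex mat"
  assumes "A \<in> carrier_mat d d" "B \<in> carrier_mat d d" "C \<in> carrier_mat d d" "D \<in> carrier_mat d d"
    and "k < d" "l < d"
  shows "((x \<cdot>\<^sub>m (A + B)) * (y \<cdot>\<^sub>m (C + D))) $$ (k, l) = x * y *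
      ((A * C) $$ (k, l) + (A * D) $$ (k, l) + (B * C) $$ (k, l) + (B * D) $$ (k, l))"
    and "((x \<cdot>\<^sub>m (A + B)) * (y \<cdot>\<^sub>m (C - D))) $$ (k, l) = x * y *
      ((A * C) $$ (k, l) - (A * D) $$ (k, l) + (B * C) $$ (k, l) - (B * D) $$ (k, l))"
    and "((x \<cdot>\<^sub>m (A - B)) * (y \<cdot>\<^sub>m (C + D))) $$ (k, l) = x * y *
      ((A * C) $$ (k, l) + (A * D) $$ (k, l) - (B * C) $$ (k, l) - (B * D) $$ (k, l))"
    and "((x \<cdot>\<^sub>m (A - B)) * (y \<cdot>\<^sub>m (C - D))) $$ (k, l) = x * y *
      ((A * C) $$ (k, l) - (A * D) $$ (k, l) - (B * C) $$ (k, l) + (B * D) $$ (k, l))"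
  using assms
  by (simp_all add: mult_entry[where d = d] minus_carrier_mat sum_distrib_left sum.distrib
      sum_subtractf algebra_simps del: index_mult_mat(1))

lemmas J_entry = smult_add_mult_entry[where A = "J_plus d" and B = "J_minus d"
    and C = "J_plus d" and D = "J_minus d" and d = d for d, OF J_carrier(1,2,1,2)]

lemma J_commutators:
  "J1 d * J2 d - J2 d * J1 d = \<i> \<cdot>\<^sub>m J3 d"
  "J2 d * J3 d - J3 d * J2 d = \<i> \<cdot>\<^sub>m J1 d"
  "J3 d * J1 d - J1 d * J3 d = \<i> \<cdot>\<^sub>m J2 d"
proof -
  show "J1 d * J2 d - J2 d * J1 d = \<i> \<cdot>\<^sub>m J3 d"
  proof (rule eq_matI)
    fix k l assume "k < dim_row (\<i> \<cdot>\<^sub>m J3 d)" "l < dim_col (\<i> \<cdot>\<^sub>m J3 d)"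
    then have kl: "k < d" "l < d" by simp_all
    have "(J1 d * J2 d - J2 d * J1 d) $$ (k, l) = (J1 d * J2 d) $$ (k, l) - (J2 d * J1 d) $$ (k, l)"
      using kl by (simp del: index_mult_mat(1))
    also have "\<dots> = (\<i> \<cdot>\<^sub>m J3 d) $$ (k, l)"
      using kl unfolding J1_def J2_def J_entry[OF kl] J_plus_minus[OF kl] J_minus_plus[OF kl]
      by (simp add: J3_def weight_def spin_def field_simps)
    finally show "(J1 d * J2 d - J2 d * J1 d) $$ (k, l) = (\<i> \<cdot>\<^sub>m J3 d) $$ (k, l)" .
  qed simp_all
  show "J2 d * J3 d - J3 d * J2 d = \<i> \<cdot>\<^sub>m J1 d"
  proof (rule eq_matI)
    fix k l assume "k < dim_row (\<i> \<cdot>\<^sub>m J1 d)" "l < dim_col (\<i> \<cdot>\<^sub>m J1 d)"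
    then have kl: "k < d" "l < d" by simp_all
    have "(J2 d * J3 d - J3 d * J2 d) $$ (k, l) = (J2 d * J3 d) $$ (k, l) - (J3 d * J2 d) $$ (k, l)"
      using kl by (simp del: index_mult_mat(1))
    also have "\<dots> = J2 d $$ (k, l) * complex_of_real (weight d l - weight d k)"
      using kl by (simp add: J3_mult_left J3_mult_right algebra_simps del: index_mult_mat(1))
    also have "\<dots> = (\<i> \<cdot>\<^sub>m J1 d) $$ (k, l)"
      using kl by (auto simp: J1_def J2_def J_plus_ladder J_minus_ladder weight_def spin_def field_simps)
    finally show "(J2 d * J3 d - J3 d * J2 d) $$ (k, l) = (\<i> \<cdot>\<^sub>m J1 d) $$ (k, l)" .
  qed simp_all
  show "J3 d * J1 d - J1 d * J3 d = \<i> \<cdot>\<^sub>m J2 d"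
  proof (rule eq_matI)
    fix k l assume "k < dim_row (\<i> \<cdot>\<^sub>m J2 d)" "l < dim_col (\<i> \<cdot>\<^sub>m J2 d)"
    then have kl: "k < d" "l < d" by simp_all
    have "(J3 d * J1 d - J1 d * J3 d) $$ (k, l) = (J3 d * J1 d) $$ (k, l) - (J1 d * J3 d) $$ (k, l)"
      using kl by (simp del: index_mult_mat(1))
    also have "\<dots> = J1 d $$ (k, l) * complex_of_real (weight d k - weight d l)"
      using kl by (simp add: J3_mult_left J3_mult_right algebra_simps del: index_mult_mat(1))
    also have "\<dots> = (\<i> \<cdot>\<^sub>m J2 d) $$ (k, l)"
      using kl by (auto simp: J1_def J2_def J_plus_ladder J_minus_ladder weight_def spin_def field_simps)
    finally show "(J3 d * J1 d - J1 d * J3 d) $$ (k, l) = (\<i> \<cdot>\<^sub>m J2 d) $$ (k, l)" .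
  qed simp_all
qed

lemma J_casimir:
  "J1 d * J1 d + J2 d * J2 d + J3 d * J3 d
     = complex_of_real (spin d * (spin d + 1)) \<cdot>\<^sub>m 1\<^sub>m d"
proof (rule eq_matI)
  let ?R = "complex_of_real (spin d * (spin d + 1)) \<cdot>\<^sub>m 1\<^sub>m d"
  show "dim_row (J1 d * J1 d + J2 d * J2 d + J3 d * J3 d) = dim_row ?R"
    "dim_col (J1 d * J1 d + J2 d * J2 d + J3 d * J3 d) = dim_col ?R"
    by simp_all
  fix k l assume "k < dim_row ?R" "l < dim_col ?R"
  then have kl: "k < d" "l < d" by simp_all
  have "(J1 d * J1 d + J2 d * J2 d + J3 d * J3 d) $$ (k, l)
      = (J1 d * J1 d) $$ (k, l) + (J2 d * J2 d) $$ (k, l) + (J3 d * J3 d) $$ (k, l)"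
    using kl by (simp del: index_mult_mat(1))
  also have "(J3 d * J3 d) $$ (k, l) = complex_of_real (weight d k) * J3 d $$ (k, l)"
    using kl by (simp add: J3_mult_left del: index_mult_mat(1))
  also have "(J1 d * J1 d) $$ (k, l) + (J2 d * J2 d) $$ (k, l) + complex_of_real (weight d k) * J3 d $$ (k, l)
      = ?R $$ (k, l)"
    using kl unfolding J1_def J2_def J_entry[OF kl] J_plus_minus[OF kl] J_minus_plus[OF kl]
    by (simp add: J3_def weight_def spin_def field_simps)
  finally show "(J1 d * J1 d + J2 d * J2 d + J3 d * J3 d) $$ (k, l) = ?R $$ (k, l)" .
qed


section \<open>Tensors\<close>

text \<open>
  A vector of the n-fold tensor power of V_j is given by its components in the product basis,
  which is indexed by the maps from the factors {1..n} to {..<d}; components outside this index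
  set are fixed to be 0.  Maps out of a set A of factors are extensional, so that
  \<open>override_on c a A\<close> joins a basis index \<open>a\<close> on A with one \<open>c\<close> on the complement.
\<close>

definition configs :: "nat \<Rightarrow> nat set \<Rightarrow> (nat \<Rightarrow> nat) set" where
  "configs d A = A \<rightarrow>\<^sub>E {..<d}"

definition tensor_space :: "nat \<Rightarrow> nat \<Rightarrow> ((nat \<Rightarrow> nat) \<Rightarrow> complex) set" where
  "tensor_space n d = {\<psi>. \<forall>s. s \<notin> configs d {1..n} \<longrightarrow> \<psi> s = 0}"

definition qudit_state :: "nat \<Rightarrow> nat \<Rightarrow> ((nat \<Rightarrow> nat) \<Rightarrow> complex) \<Rightarrow> bool" where
  "qudit_state n d \<psi> \<longleftrightarrow>
     \<psi> \<in> tensor_space n d \<and> (\<Sum>s\<in>configs d {1..n}. (cmod (\<psi> s))\<^sup>2) = 1"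

definition act_on :: "nat \<Rightarrow> nat \<Rightarrow> complex mat \<Rightarrow> ((nat \<Rightarrow> nat) \<Rightarrow> complex) \<Rightarrow> (nat \<Rightarrow> nat) \<Rightarrow> complex" where
  "act_on d i M \<psi> s = (\<Sum>k<d. M $$ (s i, k) * \<psi> (s(i := k)))"

definition invariant_tensor :: "nat \<Rightarrow> nat \<Rightarrow> ((nat \<Rightarrow> nat) \<Rightarrow> complex) \<Rightarrow> bool" where
  "invariant_tensor n d \<psi> \<longleftrightarrow>
     (\<forall>J\<in>{J1 d, J2 d, J3 d}. \<forall>s\<in>configs d {1..n}. (\<Sum>i=1..n. act_on d i J \<psi> s) = 0)"

text \<open>Operators on tensor powers are given by their matrix elements in the product basis.\<close>

definition projector :: "((nat \<Rightarrow> nat) \<Rightarrow> complex) \<Rightarrow> (nat \<Rightarrow> nat) \<Rightarrow> (nat \<Rightarrow> nat) \<Rightarrow> complex" where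
  "projector \<psi> s t = \<psi> s * cnj (\<psi> t)"

definition partial_trace :: "nat \<Rightarrow> nat set \<Rightarrow> nat set
    \<Rightarrow> ((nat \<Rightarrow> nat) \<Rightarrow> (nat \<Rightarrow> nat) \<Rightarrow> complex) \<Rightarrow> (nat \<Rightarrow> nat) \<Rightarrow> (nat \<Rightarrow> nat) \<Rightarrow> complex" where
  "partial_trace d A B R a b =
     (\<Sum>c\<in>configs d B. R (override_on c a A) (override_on c b A))"

definition reduced_density :: "nat \<Rightarrow> nat \<Rightarrow> nat set \<Rightarrow> ((nat \<Rightarrow> nat) \<Rightarrow> complex)
    \<Rightarrow> (nat \<Rightarrow> nat) \<Rightarrow> (nat \<Rightarrow> nat) \<Rightarrow> complex" where
  "reduced_density n d A \<psi> = partial_trace d A ({1..n} - A) (projector \<psi>)"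

text \<open>
  Maximal von Neumann entropy of the marginal on A means that it is the maximally mixed state,
  i.e. d^(-|A|) times the identity matrix.
\<close>

definition perfect_tensor :: "nat \<Rightarrow> nat \<Rightarrow> ((nat \<Rightarrow> nat) \<Rightarrow> complex) \<Rightarrow> bool" where
  "perfect_tensor n d \<psi> \<longleftrightarrow>
     (\<forall>A. A \<subseteq> {1..n} \<and> 1 \<le> card A \<and> card A \<le> n div 2 \<longrightarrow>
        (\<forall>a\<in>configs d A. \<forall>b\<in>configs d A.
           reduced_density n d A \<psi> a b = (if a = b then 1 / of_nat d ^ card A else 0)))"

definition invariant_perfect_tensor :: "nat \<Rightarrow> nat \<Rightarrow> ((nat \<Rightarrow> nat) \<Rightarrow> complex) \<Rightarrow> bool" where
  "invariant_perfect_tensor n d \<psi> \<longleftrightarrow>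
     qudit_state n d \<psi> \<and> invariant_tensor n d \<psi> \<and> perfect_tensor n d \<psi>"

end

theory Submission
  imports Defs
begin

text \<open>
  Measuring every factor of an invariant tensor in the weight basis gives random weights
  \<open>w\<^sub>1, \<dots>, w\<^sub>n\<close> with \<open>w\<^sub>1 + \<dots> + w\<^sub>n = 0\<close>, so that the expectation of \<open>w\<^sub>1 (w\<^sub>1 + \<dots> + w\<^sub>n)\<close>
  vanishes.  If the tensor is perfect and \<open>n \<ge> 4\<close>, any two factors are maximally mixed, hence the
  weights are pairwise independent and uniform, with mean 0.  Then the same expectation is the
  variance of \<open>w\<^sub>1\<close>, which is positive for \<open>d \<ge> 2\<close>.
\<close>

text \<open>Gluing with \<open>override_on\<close> is a bijection whose inverse is the pair of
  restrictions to \<open>A\<close> and \<open>S - A\<close>. It exposes the inner sum over the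
  complement that occurs in a partial trace.\<close>

lemma sum_configs_split:
  assumes "A \<subseteq> S"
  shows "(\<Sum>s\<in>configs d S. f s) = (\<Sum>a\<in>configs d A. \<Sum>c\<in>configs d (S - A). f (override_on c a A))"
proof -
  have "(\<Sum>s\<in>configs d S. f s)
      = (\<Sum>(a, c)\<in>configs d A \<times> configs d (S - A). f (override_on c a A))"
  proof (rule sum.reindex_bij_witness[where i = "\<lambda>(a, c). override_on c a A"
        and j = "\<lambda>s. (restrict s A, restrict s (S - A))"])
    fix s assume s: "s \<in> configs d S"
    show eq: "(case (restrict s A, restrict s (S - A)) of (a, c) \<Rightarrow> override_on c a A) = s"
      using s assms by (auto simp: configs_def override_on_def PiE_iff extensional_def fun_eq_iff)
    show "(restrict s A, restrict s (S - A)) \<in> configs d A \<times> configs d (S - A)"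
      using s assms by (auto simp: configs_def)
    show "(case (restrict s A, restrict s (S - A)) of (a, c) \<Rightarrow> f (override_on c a A)) = f s"
      using eq by simp
  next
    fix p assume p: "p \<in> configs d A \<times> configs d (S - A)"
    then obtain a c where ac: "p = (a, c)" "a \<in> configs d A" "c \<in> configs d (S - A)" by auto
    have "restrict (override_on c a A) A = a" "restrict (override_on c a A) (S - A) = c"
      using ac by (auto simp: configs_def override_on_def PiE_iff extensional_def fun_eq_iff)
    with ac show "(restrict (case p of (a, c) \<Rightarrow> override_on c a A) A,
        restrict (case p of (a, c) \<Rightarrow> override_on c a A) (S - A)) = p" by simp
    show "(case p of (a, c) \<Rightarrow> override_on c a A) \<in> configs d S"
      using ac assms by (auto simp: configs_def override_on_def PiE_iff extensional_def)
  qed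
  then show ?thesis by (simp add: sum.cartesian_product)
qed

text \<open>The squared moduli of the components form the joint distribution of the measured
  indices. Perfection makes its marginal on \<open>A\<close> uniform, so the indices in
  \<open>A\<close> are independent and the expectation factors.\<close>

lemma perfect_tensor_expectation:
  fixes g :: "nat \<Rightarrow> nat \<Rightarrow> real"
  assumes "perfect_tensor n d \<psi>" and A: "A \<subseteq> {1..n}" "1 \<le> card A" "card A \<le> n div 2"
  shows "(\<Sum>s\<in>configs d {1..n}. (cmod (\<psi> s))\<^sup>2 * (\<Prod>i\<in>A. g i (s i)))
      = (\<Prod>i\<in>A. \<Sum>k<d. g i k) / real d ^ card A"
proof -
  have fin: "finite A" using A(1) finite_subset by blast
  have marginal: "(\<Sum>c\<in>configs d ({1..n} - A). (cmod (\<psi> (override_on c a A)))\<^sup>2) = 1 / real d ^ card A"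
    if "a \<in> configs d A" for a
  proof -
    \<comment> \<open>A diagonal entry of the reduced density matrix is the probability of measuring
      \<open>a\<close> on \<open>A\<close>.\<close>
    have "complex_of_real (\<Sum>c\<in>configs d ({1..n} - A). (cmod (\<psi> (override_on c a A)))\<^sup>2)
        = reduced_density n d A \<psi> a a"
      by (simp add: reduced_density_def partial_trace_def projector_def complex_norm_square
          del: of_real_power)
    also have "\<dots> = complex_of_real (1 / real d ^ card A)"
      using assms that by (simp add: perfect_tensor_def)
    finally show ?thesis by (simp only: of_real_eq_iff)
  qed
  have "(\<Sum>s\<in>configs d {1..n}. (cmod (\<psi> s))\<^sup>2 * (\<Prod>i\<in>A. g i (s i)))
      = (\<Sum>a\<in>configs d A. (\<Sum>c\<in>configs d ({1..n} - A). (cmod (\<psi> (override_on c a A)))\<^sup>2)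
          * (\<Prod>i\<in>A. g i (a i)))"
    unfolding sum_configs_split[OF A(1)] sum_distrib_right by simp
  also have "\<dots> = (\<Sum>a\<in>configs d A. \<Prod>i\<in>A. g i (a i)) / real d ^ card A"
    by (simp add: marginal sum_divide_distrib del: One_nat_def)
  also have "(\<Sum>a\<in>configs d A. \<Prod>i\<in>A. g i (a i)) = (\<Prod>i\<in>A. \<Sum>k<d. g i k)"
    using fin by (simp add: configs_def prod_sum_PiE)
  finally show ?thesis .
qed

text \<open>The total \<open>J3\<close> is diagonal in the product basis and multiplies the
  component at \<open>s\<close> by the total weight of \<open>s\<close>.\<close>

lemma invariant_tensor_weight:
  assumes "invariant_tensor n d \<psi>" and s: "s \<in> configs d {1..n}" and "\<psi> s \<noteq> 0"
  shows "(\<Sum>i=1..n. weight d (s i)) = 0"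
proof -
  have "act_on d i (J3 d) \<psi> s = complex_of_real (weight d (s i)) * \<psi> s" if "i \<in> {1..n}" for i
  proof -
    have "s i < d" using s that by (auto simp: configs_def)
    then have "act_on d i (J3 d) \<psi> s
        = (\<Sum>k<d. if k = s i then complex_of_real (weight d (s i)) * \<psi> s else 0)"
      unfolding act_on_def by (intro sum.cong) (auto simp: J3_def)
    with \<open>s i < d\<close> show ?thesis by simp
  qed
  then have "(\<Sum>i=1..n. complex_of_real (weight d (s i)) * \<psi> s) = (\<Sum>i=1..n. act_on d i (J3 d) \<psi> s)"
    by (intro sum.cong) auto
  also have "\<dots> = 0"
    using assms(1) s by (auto simp: invariant_tensor_def)
  finally have "complex_of_real (\<Sum>i=1..n. weight d (s i)) * \<psi> s = 0"
    by (simp add: sum_distrib_right)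
  with \<open>\<psi> s \<noteq> 0\<close> show ?thesis by (simp del: of_real_sum)
qed

lemma sum_weight: "(\<Sum>k<d. weight d k) = 0"
proof -
  \<comment> \<open>The number of terms is decoupled from \<open>d\<close>, on which each weight
    depends, so that induction applies.\<close>
  have "(\<Sum>k<m. weight d k) = real m * (real d - real m) / 2" for m
    by (induction m) (simp_all add: weight_def spin_def field_simps)
  from this[of d] show ?thesis by simp
qed

lemma sum_weight_square_pos:
  assumes "d \<ge> 2"
  shows "(\<Sum>k<d. (weight d k)\<^sup>2) > 0"
proof (rule sum_pos2[where i = 0])
  \<comment> \<open>Index 0 carries the highest weight \<open>spin d\<close>, positive for d \<ge>
    2.\<close>
  show "0 < (weight d 0)\<^sup>2" using assms by (simp add: weight_def spin_def)
qed (use assms in auto)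

theorem no_invariant_perfect_tensor:
  assumes "d \<ge> 2" "n \<ge> 4"
  shows "\<not> invariant_perfect_tensor n d \<psi>"
proof
  assume "invariant_perfect_tensor n d \<psi>"
  then have inv: "invariant_tensor n d \<psi>" and perf: "perfect_tensor n d \<psi>"
    by (auto simp: invariant_perfect_tensor_def)
  define E where "E f = (\<Sum>s\<in>configs d {1..n}. (cmod (\<psi> s))\<^sup>2 * f s)" for f :: "(nat \<Rightarrow> nat) \<Rightarrow> real"
  let ?w = "weight d"
  \<comment> \<open>Here n \<ge> 4 enters: a pair of factors has size at most
    \<open>n div 2\<close>.\<close>
  have cov: "E (\<lambda>s. ?w (s 1) * ?w (s i)) = 0" if "i \<in> {2..n}" for i
    using perfect_tensor_expectation[OF perf, of "{1, i}" "\<lambda>_. ?w"] that assms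
    by (simp add: E_def sum_weight)
  \<comment> \<open>For i = 1 the pair collapses to a singleton, so the square is taken as a single
    one-factor function.\<close>
  have var: "E (\<lambda>s. ?w (s 1) * ?w (s 1)) = (\<Sum>k<d. (?w k)\<^sup>2) / real d"
    using perfect_tensor_expectation[OF perf, of "{1}" "\<lambda>_ k. (?w k)\<^sup>2"] assms
    by (simp add: E_def power2_eq_square)
  \<comment> \<open>Termwise, either the component of \<open>\<psi>\<close> at \<open>s\<close> or
    the total weight of \<open>s\<close> is zero.\<close>
  have "0 = E (\<lambda>s. ?w (s 1) * (\<Sum>i=1..n. ?w (s i)))"
    unfolding E_def
    by (rule sum.neutral[symmetric]) (use invariant_tensor_weight[OF inv] in fastforce)
  also have "\<dots> = (\<Sum>i=1..n. E (\<lambda>s. ?w (s 1) * ?w (s i)))"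
    unfolding E_def sum_distrib_left by (rule sum.swap)
  also have "\<dots> = E (\<lambda>s. ?w (s 1) * ?w (s 1)) + (\<Sum>i=2..n. E (\<lambda>s. ?w (s 1) * ?w (s i)))"
    using assms by (simp add: sum.atLeast_Suc_atMost numeral_2_eq_2)
  also have "\<dots> = (\<Sum>k<d. (?w k)\<^sup>2) / real d"
    using cov var by simp
  also have "\<dots> > 0"
    using sum_weight_square_pos[OF assms(1)] assms by simp
  finally show False by simp
qed

theorem theorem1:
  fixes d :: nat
  assumes "d \<ge> 2"
  shows "\<nexists>\<psi>. invariant_perfect_tensor 4 d \<psi>"
  using no_invariant_perfect_tensor[OF assms] by simp

end
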